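(* Let $N\ge2$, $g_1,\dots,g_N>0$ (not necessarily distinct), $f_{ij}=g_i+g_j$ for $i\ne j$, and let $y\in[0,1]^N$ with $\sum_iy_i=1$. Then, with $G=\operatorname{diag}(g_1,\dots,g_N)$, $g=(g_1,\dots,g_N)^{\sf T}$, $s=\sum_ig_iy_i$, $\mathbf 1=(1,\dots,1)^{\sf T}$, $\Pi_y=I-y\mathbf 1^{\sf T}$ and $E=\{v\in\mathbb R^N:\mathbf 1^{\sf T}v=0\}$, $$-B(y)|_E=\Pi_yG|_E+sI_E.$$ Equivalently, for every $v\in E$, $$B(y)v=-(G+sI)v+y\,(g^{\sf T}v),$$ that is, $[B(y)v]_i=y_i(g\cdot v)-(g_i+s)v_i$ for $i=1,\dots,N$.
   Context: The Maxwell--Stefan matrix $B(y)\in\mathbb R^{N\times N}$ is $B_{ij}(y)=y_if_{ij}$ for $i\ne j$ and $B_{ii}(y)=-\sum_{\ell\ne i}f_{i\ell}y_\ell$. $\Pi_y$ is the projection onto $E$ along $\operatorname{span}\{y\}$. *)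

theory Defs
  imports "HOL-Analysis.Analysis" "HOL-Library.FuncSet"
begin

(* The diagonal entries of f are never used: the sum runs over the indices l distinct from i. *)
definition MS_matrix :: "real^'n^'n \<Rightarrow> real^'n \<Rightarrow> real^'n^'n" where
  "MS_matrix f y = (\<chi> i j. if i = j then - (\<Sum>l\<in>UNIV - {i}. f$i$l * y$l) else y$i * f$i$j)"

definition diag_matrix :: "real^'n \<Rightarrow> real^'n^'n" where
  "diag_matrix g = (\<chi> i j. if i = j then g$i else 0)"

(* The numeral 1 at type real^'n is the all-ones vector. *)
definition E_space :: "(real^'n) set" where
  "E_space = {v. 1 \<bullet> v = 0}"

definition Pi_matrix :: "real^'n \<Rightarrow> real^'n^'n" where
  "Pi_matrix y = mat 1 - (columnvector y :: real^1^'n) ** (rowvector 1 :: real^'n^1)"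

lemma Pi_matrix_mult_vec:
  fixes y v :: "real^'n"
  shows "Pi_matrix y *v v = v - (1 \<bullet> v) *\<^sub>R y"
proof -
  have "((columnvector y :: real^1^'n) ** (rowvector 1 :: real^'n^1)) *v v = (1 \<bullet> v) *\<^sub>R y"
    by (simp add: vec_eq_iff matrix_vector_mult_def matrix_matrix_mult_def columnvector_def
        rowvector_def inner_vec_def flip: sum_distrib_left)
  then show ?thesis
    by (simp add: Pi_matrix_def matrix_vector_mult_diff_rdistrib)
qed

(* For y with entries summing to 1, the matrix is the projection onto E along span {y}:
   its range lies in E, it fixes E pointwise, and its kernel is span {y}. *)
lemma Pi_matrix_projection:
  fixes y v :: "real^'n"
  assumes "(\<Sum>i\<in>UNIV. y$i) = 1"
  shows "Pi_matrix y *v v \<in> E_space"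
    and "v \<in> E_space \<Longrightarrow> Pi_matrix y *v v = v"
    and "Pi_matrix y *v v = 0 \<longleftrightarrow> v \<in> span {y}"
proof -
  have 1: "1 \<bullet> y = 1"
    using assms by (simp add: inner_vec_def)
  show "Pi_matrix y *v v \<in> E_space" and "v \<in> E_space \<Longrightarrow> Pi_matrix y *v v = v"
    by (simp_all add: Pi_matrix_mult_vec E_space_def inner_diff_right 1)
  show "Pi_matrix y *v v = 0 \<longleftrightarrow> v \<in> span {y}"
    by (auto simp: Pi_matrix_mult_vec span_singleton inner_diff_right 1)
qed

end

theory Submission
  imports Defs
begin

text \<open>Because f is additive off the diagonal, extending each sum over j \<noteq> i to all j,
  with 2 g_i as the missing diagonal entry, splits it into g_i (1 \<bullet> u) + g \<bullet> u, up
  to the correction 2 g_i u_i (\<open>sum_offdiag_additive\<close>). An entry of B(y)v involves this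
  sum for u = v, where 1 \<bullet> v = 0, and for u = y, where 1 \<bullet> y = 1; the two
  corrections cancel, leaving y_i (g \<bullet> v) - (g_i + s) v_i
  (\<open>MS_matrix_mult_vec_additive\<close>). The rank-one term (g \<bullet> v) y is what the
  projection subtracts from Gv, since 1 \<bullet> Gv = g \<bullet> v.\<close>

lemma diag_matrix_mult_vec: "diag_matrix g *v v = (\<chi> i. g$i * v$i)"
  by (simp add: vec_eq_iff diag_matrix_def matrix_vector_mult_def if_distrib[of "\<lambda>x. x * _"]
      sum.delta cong: if_cong)

lemma MS_matrix_mult_vec:
  "(MS_matrix f y *v v)$i
    = y$i * (\<Sum>j\<in>UNIV - {i}. f$i$j * v$j) - (\<Sum>l\<in>UNIV - {i}. f$i$l * y$l) * v$i"
  by (simp add: MS_matrix_def matrix_vector_mult_def sum.remove[of UNIV i] sum_distrib_left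
      mult.assoc)

text \<open>Adding the term j = i to complete the sum costs (g_i + g_i) u_i; the full sum then
  separates by distributivity.\<close>

lemma sum_offdiag_additive:
  fixes g u :: "real^'n"
  assumes "\<And>j. i \<noteq> j \<Longrightarrow> f$i$j = g$i + g$j"
  shows "(\<Sum>j\<in>UNIV - {i}. f$i$j * u$j) = g$i * (1 \<bullet> u) + g \<bullet> u - 2 * g$i * u$i"
proof -
  have "(\<Sum>j\<in>UNIV - {i}. f$i$j * u$j) = (\<Sum>j\<in>UNIV - {i}. (g$i + g$j) * u$j)"
    using assms by (intro sum.cong) auto
  also have "\<dots> = (\<Sum>j\<in>UNIV. (g$i + g$j) * u$j) - 2 * g$i * u$i"
    by (simp add: sum_diff1)
  also have "(\<Sum>j\<in>UNIV. (g$i + g$j) * u$j) = g$i * (1 \<bullet> u) + g \<bullet> u"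
    by (simp add: inner_vec_def distrib_right sum.distrib sum_distrib_left)
  finally show ?thesis .
qed

lemma MS_matrix_mult_vec_additive:
  fixes g y v :: "real^'n"
  assumes "\<And>i j. i \<noteq> j \<Longrightarrow> f$i$j = g$i + g$j"
    and "1 \<bullet> y = 1" and "v \<in> E_space"
  shows "(MS_matrix f y *v v)$i = y$i * (g \<bullet> v) - (g$i + g \<bullet> y) * v$i"
proof -
  \<comment> \<open>Kept general in \<open>u\<close> to serve for both \<open>v\<close> and
    \<open>y\<close>: the corrections contribute -2 g_i y_i v_i and +2 g_i y_i v_i.\<close>
  have "(\<Sum>j\<in>UNIV - {i}. f$i$j * u$j) = g$i * (1 \<bullet> u) + g \<bullet> u - 2 * g$i * u$i" for u
    using assms(1) by (rule sum_offdiag_additive)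
  then show ?thesis
    using assms(2,3) by (simp add: MS_matrix_mult_vec E_space_def) (simp add: algebra_simps)
qed

theorem lemma3p1:
  fixes g y :: "real^'n" and f :: "real^'n^'n" and s :: real
  assumes "CARD('n) \<ge> 2"
    and "\<And>i. g$i > 0"
    and "\<And>i j. i \<noteq> j \<Longrightarrow> f$i$j = g$i + g$j"
    and "\<And>i. 0 \<le> y$i \<and> y$i \<le> 1"
    and "(\<Sum>i\<in>UNIV. y$i) = 1"
    and "s = (\<Sum>i\<in>UNIV. g$i * y$i)"
  shows "(\<lambda>v. (- MS_matrix f y) *v v) \<in> E_space \<rightarrow> E_space
    \<and> restrict (\<lambda>v. (- MS_matrix f y) *v v) E_space
        = restrict (\<lambda>v. Pi_matrix y *v (diag_matrix g *v v) + s *\<^sub>R v) E_space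
    \<and> (\<forall>v\<in>E_space. MS_matrix f y *v v
        = - ((diag_matrix g + s *\<^sub>R mat 1) *v v) + (g \<bullet> v) *\<^sub>R y)
    \<and> (\<forall>v\<in>E_space. \<forall>i. (MS_matrix f y *v v)$i = y$i * (g \<bullet> v) - (g$i + s) * v$i)"
proof -
  have s: "s = g \<bullet> y" and y: "1 \<bullet> y = 1"
    using assms(5,6) by (simp_all add: inner_vec_def)
  have comp: "(MS_matrix f y *v v)$i = y$i * (g \<bullet> v) - (g$i + s) * v$i"
    if "v \<in> E_space" for v i
    unfolding s using MS_matrix_mult_vec_additive[OF assms(3) y that] .
  have vec: "MS_matrix f y *v v = - ((diag_matrix g + s *\<^sub>R mat 1) *v v) + (g \<bullet> v) *\<^sub>R y"
    if "v \<in> E_space" for v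
    by (simp add: vec_eq_iff comp[OF that] matrix_vector_mult_add_rdistrib
        scaleR_matrix_vector_assoc[symmetric] diag_matrix_mult_vec algebra_simps)
  \<comment> \<open>This is the coefficient of \<open>y\<close> that \<open>Pi_matrix y\<close>
    removes from Gv.\<close>
  have diag: "1 \<bullet> (diag_matrix g *v v) = g \<bullet> v" for v
    by (simp add: diag_matrix_mult_vec inner_vec_def)
  have proj: "(- MS_matrix f y) *v v = Pi_matrix y *v (diag_matrix g *v v) + s *\<^sub>R v"
    if "v \<in> E_space" for v
  proof -
    \<comment> \<open>The negated matrix is treated as the difference
      \<open>0 - MS_matrix f y\<close>.\<close>
    have "(- MS_matrix f y) *v v = - (MS_matrix f y *v v)"
      using matrix_vector_mult_diff_rdistrib[of 0 "MS_matrix f y" v] by simp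
    then show ?thesis
      by (simp add: vec[OF that] Pi_matrix_mult_vec diag matrix_vector_mult_add_rdistrib
          scaleR_matrix_vector_assoc[symmetric])
  qed
  \<comment> \<open>Invariance of E is read off the projected form: the projection lands in E, and s
    v stays there.\<close>
  have "(- MS_matrix f y) *v v \<in> E_space" if "v \<in> E_space" for v
    using Pi_matrix_projection(1)[OF assms(5), of "diag_matrix g *v v"] that
    by (simp add: proj[OF that] E_space_def inner_add_right)
  then show ?thesis
    using proj vec comp by (auto intro!: restrict_ext)
qed

end
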